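(* Let $\lambda\in(0,1]$ and let $f(z)=z+\sum_{m=2}^{\infty}a_m z^m+\overline{\sum_{m=2}^{\infty}b_m z^m}\in\mathcal{F}^0_{\mathcal{H}}(\lambda)$ satisfy also the condition $\sum_{m=2}^\infty m(|a_m|+|b_m|)\le\lambda$. Then $$r-\frac{\lambda}{2}r^2\le|f(z)|\le r+\frac{\lambda}{2}r^2\qquad(|z|=r<1)$$ and $$|z|+\sum_{m=2}^\infty(|a_m|+|b_m|)|z|^m\le d(f(0),\partial f(\mathbb{D}))$$ for $|z|\le r^*$, where $$r^*=\frac{-1+\sqrt{1+2\lambda\left(1-\frac{\lambda}{2}\right)}}{\lambda}.$$ The radius $r^*$ is the Bohr radius (the largest radius for which the last inequality holds for all $f\in\mathcal{F}^0_{\mathcal{H}}(\lambda)$ satisfying the coefficient condition), and it is obtained for $f(z)=z-\frac{\lambda}{2}z^2$.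
   Context: $\mathbb{D}=\{z\in\mathbb{C}:|z|<1\}$; $d(f(0),\partial f(\mathbb{D}))$ is the Euclidean distance from $f(0)$ to the boundary of $f(\mathbb{D})$. $\mathcal{H}_0$ is the class of complex-valued harmonic functions $f=h+\bar g$ on $\mathbb{D}$ with $h(z)=z+\sum_{m=2}^\infty a_mz^m$ and $g(z)=\sum_{m=2}^\infty b_mz^m$ analytic in $\mathbb{D}$. $\mathcal{F}^0_{\mathcal{H}}(\lambda)$ is the class of $f=h+\bar g\in\mathcal{H}_0$ with $|f_z(z)-1|<\lambda-|f_{\bar z}(z)|$ for all $z\in\mathbb{D}$, where $f_z=h'$ and $f_{\bar z}=\overline{g'}$. *)

theory Defs
  imports "HOL-Complex_Analysis.Complex_Analysis"
begin

abbreviation unit_disc :: "complex set" where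
  "unit_disc \<equiv> ball 0 1"

text \<open>The Wirtinger derivatives \<open>(f\<^sub>x - \<i> f\<^sub>y) / 2\<close> and
  \<open>(f\<^sub>x + \<i> f\<^sub>y) / 2\<close>; the real partial derivatives are the values of
  the Frechet derivative in the directions \<open>1\<close> and \<open>\<i>\<close>. The lemmas \<open>wirtinger_decomp\<close> and
  \<open>wirtinger_bar_decomp\<close> below show that for \<open>f = h + cnj g\<close> they are \<open>h'\<close> and \<open>cnj g'\<close>.\<close>

definition wirtinger :: "(complex \<Rightarrow> complex) \<Rightarrow> complex \<Rightarrow> complex" where
  "wirtinger f z =
     (frechet_derivative f (at z) 1 - \<i> * frechet_derivative f (at z) \<i>) / 2"

definition wirtinger_bar :: "(complex \<Rightarrow> complex) \<Rightarrow> complex \<Rightarrow> complex" where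
  "wirtinger_bar f z =
     (frechet_derivative f (at z) 1 + \<i> * frechet_derivative f (at z) \<i>) / 2"

text \<open>\<open>f = h + cnj g\<close> on the unit disc with \<open>h z = z + (\<Sum>m\<ge>2. a m * z ^ m)\<close> and
  \<open>g z = (\<Sum>m\<ge>2. b m * z ^ m)\<close>. Series over \<open>m \<ge> 2\<close> are written with a shifted index, so the
  values of \<open>a\<close> and \<open>b\<close> at \<open>0\<close> and \<open>1\<close> play no role.\<close>

definition H0_expansion ::
  "(complex \<Rightarrow> complex) \<Rightarrow> (nat \<Rightarrow> complex) \<Rightarrow> (nat \<Rightarrow> complex) \<Rightarrow> bool" where
  "H0_expansion f a b \<longleftrightarrow>
     (\<exists>h g. h analytic_on unit_disc \<and> g analytic_on unit_disc \<and>
        (\<forall>z\<in>unit_disc. (\<lambda>m. a (m + 2) * z ^ (m + 2)) sums (h z - z)) \<and>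
        (\<forall>z\<in>unit_disc. (\<lambda>m. b (m + 2) * z ^ (m + 2)) sums g z) \<and>
        (\<forall>z\<in>unit_disc. f z = h z + cnj (g z)))"

definition H0 :: "(complex \<Rightarrow> complex) set" where
  "H0 = {f. \<exists>a b. H0_expansion f a b}"

definition FH0 :: "real \<Rightarrow> (complex \<Rightarrow> complex) set" where
  "FH0 lam =
     {f \<in> H0. \<forall>z\<in>unit_disc. norm (wirtinger f z - 1) < lam - norm (wirtinger_bar f z)}"

definition coeff_condition :: "real \<Rightarrow> (nat \<Rightarrow> complex) \<Rightarrow> (nat \<Rightarrow> complex) \<Rightarrow> bool" where
  "coeff_condition lam a b \<longleftrightarrow>
     summable (\<lambda>m. real (m + 2) * (norm (a (m + 2)) + norm (b (m + 2)))) \<and>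
     (\<Sum>m. real (m + 2) * (norm (a (m + 2)) + norm (b (m + 2)))) \<le> lam"

text \<open>The functions under consideration, together with their coefficients (which are determined
  by the function for indices \<open>m \<ge> 2\<close>).\<close>

definition FH0_coeff ::
  "real \<Rightarrow> (complex \<Rightarrow> complex) \<Rightarrow> (nat \<Rightarrow> complex) \<Rightarrow> (nat \<Rightarrow> complex) \<Rightarrow> bool" where
  "FH0_coeff lam f a b \<longleftrightarrow> f \<in> FH0 lam \<and> H0_expansion f a b \<and> coeff_condition lam a b"

text \<open>The series converges for \<open>0 \<le> r \<le> 1\<close> under the coefficient condition.\<close>

definition bohr_sum :: "(nat \<Rightarrow> complex) \<Rightarrow> (nat \<Rightarrow> complex) \<Rightarrow> real \<Rightarrow> real" where
  "bohr_sum a b r = r + (\<Sum>m. (norm (a (m + 2)) + norm (b (m + 2))) * r ^ (m + 2))"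

definition boundary_dist :: "(complex \<Rightarrow> complex) \<Rightarrow> real" where
  "boundary_dist f = infdist (f 0) (frontier (f ` unit_disc))"

definition bohr_radii :: "real \<Rightarrow> real set" where
  "bohr_radii lam = {r. 0 \<le> r \<and> r < 1 \<and>
     (\<forall>f a b. FH0_coeff lam f a b \<longrightarrow>
        (\<forall>z::complex. norm z \<le> r \<longrightarrow> bohr_sum a b (norm z) \<le> boundary_dist f))}"

definition is_bohr_radius :: "real \<Rightarrow> real \<Rightarrow> bool" where
  "is_bohr_radius lam R \<longleftrightarrow> R \<in> bohr_radii lam \<and> (\<forall>r\<in>bohr_radii lam. r \<le> R)"

definition r_star :: "real \<Rightarrow> real" where
  "r_star lam = (- 1 + sqrt (1 + 2 * lam * (1 - lam / 2))) / lam"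

definition extremal :: "real \<Rightarrow> complex \<Rightarrow> complex" where
  "extremal lam z = z - of_real (lam / 2) * z ^ 2"

definition extremal_a :: "real \<Rightarrow> nat \<Rightarrow> complex" where
  "extremal_a lam m = (if m = 2 then - of_real (lam / 2) else 0)"

lemma frechet_derivative_decomp:
  assumes "h analytic_on unit_disc" "g analytic_on unit_disc"
    and f: "\<And>z. z \<in> unit_disc \<Longrightarrow> f z = h z + cnj (g z)" and z: "z \<in> unit_disc"
  shows "frechet_derivative f (at z) = (\<lambda>t. deriv h z * t + cnj (deriv g z * t))"
proof -
  have "(h has_field_derivative deriv h z) (at z)" "(g has_field_derivative deriv g z) (at z)"
    using assms by (auto simp: analytic_on_open holomorphic_derivI)
  then have hg: "(h has_derivative (\<lambda>t. deriv h z * t)) (at z)"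
      "(g has_derivative (\<lambda>t. deriv g z * t)) (at z)"
    by (auto simp: has_field_derivative_def)
  then have "((\<lambda>w. h w + cnj (g w)) has_derivative
      (\<lambda>t. deriv h z * t + cnj (deriv g z * t))) (at z)"
    by (intro has_derivative_add bounded_linear.has_derivative[OF bounded_linear_cnj])
  then have "(f has_derivative (\<lambda>t. deriv h z * t + cnj (deriv g z * t))) (at z)"
    by (rule has_derivative_transform_within_open[where s = unit_disc]) (use f z in auto)
  then show ?thesis
    by (metis frechet_derivative_at)
qed

lemma wirtinger_decomp:
  assumes "h analytic_on unit_disc" "g analytic_on unit_disc"
    and "\<And>z. z \<in> unit_disc \<Longrightarrow> f z = h z + cnj (g z)" and "z \<in> unit_disc"
  shows "wirtinger f z = deriv h z"
  using frechet_derivative_decomp[OF assms] by (simp add: wirtinger_def algebra_simps)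

lemma wirtinger_bar_decomp:
  assumes "h analytic_on unit_disc" "g analytic_on unit_disc"
    and "\<And>z. z \<in> unit_disc \<Longrightarrow> f z = h z + cnj (g z)" and "z \<in> unit_disc"
  shows "wirtinger_bar f z = cnj (deriv g z)"
  using frechet_derivative_decomp[OF assms] by (simp add: wirtinger_bar_def algebra_simps)

end

theory Submission imports Defs begin

text \<open>The coefficient condition gives \<open>\<bar>f z - z\<bar> \<le> lam / 2 * \<bar>z\<bar>\<^sup>2\<close>. Hence for \<open>\<bar>w\<bar> < 1 - lam / 2\<close>
  the map \<open>z \<mapsto> w - (f z - z)\<close> sends the closed disc of radius \<open>\<bar>w\<bar> + lam / 2 < 1\<close> into itself,
  and a Brouwer fixed point solves \<open>f z = w\<close>. So the image contains the disc of radius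
  \<open>1 - lam / 2\<close>, which bounds the boundary distance from below; \<open>r_star lam\<close> is the
  positive root of \<open>r + lam / 2 * r\<^sup>2 = 1 - lam / 2\<close>. For the extremal function the value
  \<open>1 - lam / 2\<close> at the point \<open>1\<close> is a boundary point of the image.\<close>

section \<open>Coefficient estimates and growth bounds\<close>

lemma coeff_condition_majorant:
  assumes "coeff_condition lam a b" "0 \<le> r" "r \<le> 1"
  shows "summable (\<lambda>m. (norm (a (m + 2)) + norm (b (m + 2))) * r ^ (m + 2))"
    and "(\<Sum>m. (norm (a (m + 2)) + norm (b (m + 2))) * r ^ (m + 2)) \<le> lam / 2 * r\<^sup>2"
proof -
  let ?c = "\<lambda>m. norm (a (m + 2)) + norm (b (m + 2))"
  let ?s = "\<lambda>m. real (m + 2) * ?c m"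
  have s: "summable ?s" "suminf ?s \<le> lam"
    using assms(1) by (auto simp: coeff_condition_def)
  have s': "summable (\<lambda>m. r\<^sup>2 / 2 * ?s m)"
    using s(1) by (rule summable_mult)
  \<comment> \<open>The powers start at exponent 2, so \<open>r ^ (m + 2)\<close> is at most
    \<open>r\<^sup>2\<close> and \<open>1\<close> is at most \<open>real (m + 2) / 2\<close>. The
    second estimate is the source of the factor 1/2.\<close>
  have le: "?c m * r ^ (m + 2) \<le> r\<^sup>2 / 2 * ?s m" for m
  proof -
    have "?c m * r ^ (m + 2) \<le> ?c m * r\<^sup>2"
      using assms by (intro mult_left_mono power_decreasing) auto
    also have "\<dots> \<le> ?c m * (r\<^sup>2 / 2 * real (m + 2))"
      by (intro mult_left_mono) (auto simp: field_simps)
    finally show ?thesis by (simp only: mult_ac)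
  qed
  show sm: "summable (\<lambda>m. ?c m * r ^ (m + 2))"
    by (rule summable_comparison_test'[OF s', of 0]) (use le assms in \<open>auto simp: abs_mult\<close>)
  have "(\<Sum>m. ?c m * r ^ (m + 2)) \<le> (\<Sum>m. r\<^sup>2 / 2 * ?s m)"
    using le sm s' by (rule suminf_le)
  also have "\<dots> = r\<^sup>2 / 2 * suminf ?s"
    using s(1) by (rule suminf_mult)
  also have "\<dots> \<le> r\<^sup>2 / 2 * lam"
    using s(2) by (intro mult_left_mono) auto
  finally show "(\<Sum>m. ?c m * r ^ (m + 2)) \<le> lam / 2 * r\<^sup>2"
    by (simp add: mult.commute del: power_Suc)
qed

text \<open>Conjugation passes through the series for \<open>g\<close>, so \<open>f z - z\<close> is
  a single series whose terms are dominated by the majorant at \<open>r = norm z\<close>.\<close>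

lemma norm_H0_minus_id_le:
  assumes "H0_expansion f a b" "coeff_condition lam a b" "norm z < 1"
  shows "norm (f z - z) \<le> lam / 2 * (norm z)\<^sup>2"
proof -
  obtain h g where
      "\<forall>z\<in>unit_disc. (\<lambda>m. a (m + 2) * z ^ (m + 2)) sums (h z - z)"
      "\<forall>z\<in>unit_disc. (\<lambda>m. b (m + 2) * z ^ (m + 2)) sums g z"
      "\<forall>z\<in>unit_disc. f z = h z + cnj (g z)"
    using assms(1) unfolding H0_expansion_def by blast
  moreover have "z \<in> unit_disc"
    using assms(3) by simp
  ultimately have h: "(\<lambda>m. a (m + 2) * z ^ (m + 2)) sums (h z - z)"
    and g: "(\<lambda>m. b (m + 2) * z ^ (m + 2)) sums g z"
    and f: "f z = h z + cnj (g z)"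
    by blast+
  let ?t = "\<lambda>m. a (m + 2) * z ^ (m + 2) + cnj (b (m + 2) * z ^ (m + 2))"
  let ?c = "\<lambda>m. (norm (a (m + 2)) + norm (b (m + 2))) * norm z ^ (m + 2)"
  have "?t sums (h z - z + cnj (g z))"
    using h g by (intro sums_add) (simp_all only: sums_cnj)
  then have t: "suminf ?t = f z - z"
    by (simp add: f sums_iff)
  have c: "summable ?c" "suminf ?c \<le> lam / 2 * (norm z)\<^sup>2"
    using coeff_condition_majorant[OF assms(2), of "norm z"] assms(3) by auto
  have le: "norm (?t m) \<le> ?c m" for m
  proof -
    have "norm (?t m) \<le> norm (a (m + 2) * z ^ (m + 2)) + norm (cnj (b (m + 2) * z ^ (m + 2)))"
      by (rule norm_triangle_ineq)
    also have "\<dots> = ?c m"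
      by (simp only: complex_mod_cnj norm_mult norm_power distrib_right)
    finally show ?thesis .
  qed
  have "norm (suminf ?t) \<le> suminf ?c"
    using le c(1) by (rule norm_suminf_le)
  with t c(2) show ?thesis by simp
qed

lemma growth_bounds:
  assumes "H0_expansion f a b" "coeff_condition lam a b" "norm z < 1"
  shows "norm z - lam / 2 * (norm z)\<^sup>2 \<le> norm (f z)"
    and "norm (f z) \<le> norm z + lam / 2 * (norm z)\<^sup>2"
  using norm_H0_minus_id_le[OF assms] norm_triangle_ineq2[of z "z - f z"]
    norm_triangle_ineq2[of "f z" z] norm_triangle_ineq3[of "f z" z]
  by (auto simp: norm_minus_commute)

section \<open>The disc covered by the image and the boundary distance\<close>

lemma ball_subset_H0_image:
  assumes "H0_expansion f a b" "coeff_condition lam a b" "0 < lam"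
  shows "ball 0 (1 - lam / 2) \<subseteq> f ` unit_disc"
proof
  fix w :: complex assume "w \<in> ball 0 (1 - lam / 2)"
  define \<rho> where "\<rho> = norm w + lam / 2"
  have \<rho>: "0 \<le> \<rho>" "\<rho> < 1"
    using \<open>w \<in> _\<close> assms(3) by (auto simp: \<rho>_def)
  obtain h g where "h analytic_on unit_disc" "g analytic_on unit_disc"
    and f: "\<forall>z\<in>unit_disc. f z = h z + cnj (g z)"
    using assms(1) unfolding H0_expansion_def by blast
  \<comment> \<open>As \<open>f\<close> need not be holomorphic, the argument is topological: it
    uses only the continuity of \<open>f\<close> and its closeness to the identity.\<close>
  then have "continuous_on unit_disc (\<lambda>z. h z + cnj (g z))"
    by (intro continuous_intros) (auto intro: holomorphic_on_imp_continuous_on analytic_imp_holomorphic)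
  then have "continuous_on unit_disc f"
    by (rule continuous_on_eq) (use f in auto)
  then have cont: "continuous_on (cball 0 \<rho>) (\<lambda>z. w - (f z - z))"
    using \<rho> by (intro continuous_intros) (auto elim: continuous_on_subset)
  have "(\<lambda>z. w - (f z - z)) \<in> cball 0 \<rho> \<rightarrow> cball 0 \<rho>"
  proof
    fix z :: complex assume z: "z \<in> cball 0 \<rho>"
    with \<rho> have "norm z < 1" by auto
    then have "norm (f z - z) \<le> lam / 2 * (norm z)\<^sup>2"
      using norm_H0_minus_id_le assms by blast
    also have "\<dots> \<le> lam / 2 * 1"
      using \<open>norm z < 1\<close> assms(3) by (intro mult_left_mono power_le_one) auto
    finally have "norm (f z - z) \<le> lam / 2" by simp
    then show "w - (f z - z) \<in> cball 0 \<rho>"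
      using norm_triangle_ineq4[of w "f z - z"] by (simp add: \<rho>_def)
  qed
  then obtain z where "z \<in> cball 0 \<rho>" "w - (f z - z) = z"
    using brouwer[OF compact_cball convex_cball _ cont] \<rho> by auto
  then have "f z = w" "z \<in> unit_disc"
    using \<rho> by (auto simp: algebra_simps)
  then show "w \<in> f ` unit_disc" by blast
qed

lemma boundary_dist_H0_ge:
  assumes "H0_expansion f a b" "coeff_condition lam a b" "0 < lam"
  shows "1 - lam / 2 \<le> boundary_dist f"
proof -
  let ?F = "frontier (f ` unit_disc)"
  have "f 0 = 0"
    using growth_bounds(2)[OF assms(1,2), of 0] by simp
  \<comment> \<open>Boundedness makes the frontier nonempty. This matters because
    \<open>infdist\<close> to the empty set is 0 by convention, which would break the bound for
    \<open>lam < 2\<close>.\<close>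
  have "norm (f z) \<le> 1 + lam / 2" if "z \<in> unit_disc" for z
  proof -
    have z: "norm z < 1" using that by simp
    have "lam / 2 * (norm z)\<^sup>2 \<le> lam / 2 * 1"
      using z assms(3) by (intro mult_left_mono power_le_one) auto
    with growth_bounds(2)[OF assms(1,2) z] z show ?thesis by simp
  qed
  then have "bounded (f ` unit_disc)"
    unfolding bounded_iff by blast
  then have "f ` unit_disc \<noteq> UNIV"
    using not_bounded_UNIV by metis
  then have ne: "?F \<noteq> {}"
    by (auto simp: frontier_eq_empty)
  have "1 - lam / 2 \<le> dist (f 0) w" if "w \<in> ?F" for w
  proof (rule ccontr)
    assume "\<not> ?thesis"
    then have "w \<in> ball 0 (1 - lam / 2)" by (simp add: \<open>f 0 = 0\<close>)
    then have "w \<in> interior (f ` unit_disc)"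
      using ball_subset_H0_image[OF assms] by (meson interior_maximal open_ball subsetD)
    with that show False by (simp add: frontier_def)
  qed
  then show ?thesis
    unfolding boundary_dist_def infdist_def using ne by (auto intro!: cINF_greatest)
qed

section \<open>The quadratic inequality that determines the radius\<close>

lemma bohr_sum_le:
  assumes "coeff_condition lam a b" "0 \<le> r" "r \<le> 1"
  shows "bohr_sum a b r \<le> r + lam / 2 * r\<^sup>2"
  using coeff_condition_majorant(2)[OF assms] by (simp add: bohr_sum_def)

text \<open>Multiplying by \<open>2 * lam\<close> and completing the square turns the quadratic
  inequality into one between \<open>(lam * r + 1)\<^sup>2\<close> and the radicand. Since
  \<open>lam * r + 1\<close> is nonnegative, taking roots is reversible.\<close>

lemma le_r_star_iff:
  assumes "0 < lam" "lam \<le> 1" "0 \<le> r"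
  shows "r + lam / 2 * r\<^sup>2 \<le> 1 - lam / 2 \<longleftrightarrow> r \<le> r_star lam"
proof -
  have "r \<le> r_star lam \<longleftrightarrow> lam * r + 1 \<le> sqrt (1 + 2 * lam * (1 - lam / 2))"
    using assms by (auto simp: r_star_def field_simps)
  also have "\<dots> \<longleftrightarrow> (lam * r + 1)\<^sup>2 \<le> 1 + 2 * lam * (1 - lam / 2)"
    using assms by (metis add_nonneg_nonneg mult_nonneg_nonneg less_imp_le real_le_lsqrt
        real_sqrt_le_iff real_sqrt_abs abs_of_nonneg zero_le_one)
  also have "\<dots> \<longleftrightarrow> 2 * lam * (r + lam / 2 * r\<^sup>2) \<le> 2 * lam * (1 - lam / 2)"
    by (simp add: power2_eq_square algebra_simps)
  also have "\<dots> \<longleftrightarrow> r + lam / 2 * r\<^sup>2 \<le> 1 - lam / 2"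
    using assms(1) by (intro mult_le_cancel_left_pos) simp
  finally show ?thesis ..
qed

text \<open>The quadratic inequality of \<open>le_r_star_iff\<close> is true at \<open>r = 0\<close>
  and false at \<open>r = 1\<close>.\<close>

lemma r_star_bounds:
  assumes "0 < lam" "lam \<le> 1"
  shows "0 \<le> r_star lam" "r_star lam < 1"
proof -
  show "0 \<le> r_star lam"
    using le_r_star_iff[OF assms, of 0] assms by simp
  have "\<not> 1 \<le> r_star lam"
    using le_r_star_iff[OF assms, of 1] assms by simp
  then show "r_star lam < 1" by simp
qed

text \<open>At \<open>r_star lam\<close> the equivalence \<open>le_r_star_iff\<close> yields only an
  inequality; the exact equation gives equality for the extremal function.\<close>

lemma r_star_root:
  assumes "0 < lam" "lam \<le> 1"
  shows "r_star lam + lam / 2 * (r_star lam)\<^sup>2 = 1 - lam / 2"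
proof -
  define s where "s = sqrt (1 + 2 * lam * (1 - lam / 2))"
  have s2: "s\<^sup>2 = 1 + 2 * lam * (1 - lam / 2)"
    using assms by (simp add: s_def)
  have "lam * r_star lam = s - 1"
    using assms by (simp add: r_star_def s_def)
  then have "(lam * r_star lam + 1)\<^sup>2 = 1 + 2 * lam * (1 - lam / 2)"
    using s2 by simp
  then have "2 * lam * (r_star lam + lam / 2 * (r_star lam)\<^sup>2) = 2 * lam * (1 - lam / 2)"
    by (simp add: power2_eq_square algebra_simps)
  then show ?thesis using assms(1) by simp
qed

section \<open>The extremal function\<close>

lemma extremal_series:
  "(\<lambda>m. extremal_a lam (m + 2) * z ^ (m + 2)) sums (extremal lam z - z)"
  using sums_single[of 0 "\<lambda>m. extremal_a lam (m + 2) * z ^ (m + 2)"]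
  by (simp add: extremal_a_def extremal_def sums_iff if_distrib if_distribR power2_eq_square cong: if_cong)

text \<open>Equality holds in \<open>bohr_sum_le\<close> here: the only nonzero coefficient, of
  modulus \<open>lam / 2\<close>, sits at exponent 2 (shifted index 0), where both termwise
  estimates of the majorant are equalities.\<close>

lemma bohr_sum_extremal:
  assumes "0 < lam"
  shows "bohr_sum (extremal_a lam) (\<lambda>_. 0) r = r + lam / 2 * r\<^sup>2"
proof -
  have "(\<lambda>m. (norm (extremal_a lam (m + 2)) + norm (0 :: complex)) * r ^ (m + 2)) =
      (\<lambda>m. if m = 0 then lam / 2 * r\<^sup>2 else 0)"
    using assms by (auto simp: extremal_a_def norm_divide power2_eq_square)
  moreover have "(\<Sum>m. if m = 0 then lam / 2 * r\<^sup>2 else 0) = lam / 2 * r\<^sup>2"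
    using sums_single[of 0 "\<lambda>_. lam / 2 * r\<^sup>2"] by (rule sums_unique[symmetric])
  ultimately show ?thesis
    by (simp only: bohr_sum_def)
qed

lemma extremal_H0_expansion: "H0_expansion (extremal lam) (extremal_a lam) (\<lambda>_. 0)"
  unfolding H0_expansion_def
proof (intro exI conjI ballI)
  show "extremal lam analytic_on unit_disc"
    unfolding extremal_def[abs_def] by (intro analytic_intros)
  show "(\<lambda>_. 0) analytic_on unit_disc"
    by simp
qed (use extremal_series in auto)

text \<open>The function is holomorphic with derivative \<open>1 - lam * z\<close>, so the defining
  inequality reduces to \<open>lam * norm z < lam\<close>. The coefficient condition holds with
  equality, as \<open>2 * (lam / 2) = lam\<close>.\<close>

lemma extremal_FH0_coeff:
  assumes "0 < lam"
  shows "FH0_coeff lam (extremal lam) (extremal_a lam) (\<lambda>_. 0)"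
proof -
  have an: "extremal lam analytic_on unit_disc"
    unfolding extremal_def[abs_def] by (intro analytic_intros)
  have "norm (wirtinger (extremal lam) z - 1) < lam - norm (wirtinger_bar (extremal lam) z)"
    if z: "z \<in> unit_disc" for z
  proof -
    have "(extremal lam has_field_derivative (1 - of_real lam * z)) (at z)"
      unfolding extremal_def[abs_def] by (auto intro!: derivative_eq_intros)
    then have "wirtinger (extremal lam) z = 1 - of_real lam * z"
      using wirtinger_decomp[OF an, of "\<lambda>_. 0" "extremal lam" z] z by (simp add: DERIV_imp_deriv)
    moreover have "wirtinger_bar (extremal lam) z = 0"
      using wirtinger_bar_decomp[OF an, of "\<lambda>_. 0" "extremal lam" z] z by simp
    ultimately show ?thesis
      using z assms by (simp add: norm_mult)
  qed
  then have "extremal lam \<in> FH0 lam"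
    unfolding FH0_def H0_def using extremal_H0_expansion by blast
  moreover have "(\<lambda>m. real (m + 2) * (norm (extremal_a lam (m + 2)) + norm (0 :: complex))) =
      (\<lambda>m. if m = 0 then lam else 0)"
    using assms by (auto simp: extremal_a_def norm_divide)
  then have "coeff_condition lam (extremal_a lam) (\<lambda>_. 0)"
    using sums_single[of 0 "\<lambda>_. lam"] by (simp add: coeff_condition_def sums_iff)
  ultimately show ?thesis
    using extremal_H0_expansion by (simp add: FH0_coeff_def)
qed

lemma boundary_dist_extremal:
  assumes "0 < lam" "lam \<le> 1"
  shows "boundary_dist (extremal lam) = 1 - lam / 2"
proof (rule antisym)
  let ?D = "extremal lam ` unit_disc"
  let ?p = "extremal lam 1"
  \<comment> \<open>Continuity up to the unit circle makes the value at 1 a limit of image points.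
    It then suffices to show that this value is not attained in the open disc.\<close>
  have "continuous_on (closure unit_disc) (extremal lam)"
    unfolding extremal_def[abs_def] by (intro continuous_intros)
  then have "extremal lam ` closure unit_disc \<subseteq> closure ?D"
    by (rule image_closure_subset) (auto intro: closure_subset[THEN subsetD])
  then have "?p \<in> closure ?D"
    by (auto simp: image_subset_iff)
  moreover have "?p \<notin> ?D"
  proof
    assume "?p \<in> ?D"
    then obtain z where z: "norm z < 1" "extremal lam z = ?p" by auto
    \<comment> \<open>This is twice the difference of the values at \<open>z\<close> and at 1,
      factored. The second factor cannot vanish, because \<open>lam \<le> 1\<close> and
      \<open>norm (z + 1) < 2\<close>.\<close>
    then have "(z - 1) * (2 - of_real lam * (z + 1)) = 0"
      by (simp add: extremal_def power2_eq_square) algebra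
    moreover have "z \<noteq> 1" using z by auto
    ultimately have "of_real lam * (z + 1) = 2" by auto
    then have "lam * norm (z + 1) = 2"
      using assms by (metis norm_mult norm_of_real abs_of_pos norm_numeral)
    moreover have "norm (z + 1) < 2"
      using norm_triangle_ineq[of z 1] z by simp
    then have "lam * norm (z + 1) < 1 * 2"
      using assms by (intro mult_le_less_imp_less) auto
    ultimately show False by simp
  qed
  ultimately have "?p \<in> frontier ?D"
    using interior_subset by (auto simp: frontier_def)
  then have "boundary_dist (extremal lam) \<le> dist (extremal lam 0) ?p"
    unfolding boundary_dist_def by (rule infdist_le)
  also have "\<dots> = norm (of_real (1 - lam / 2) :: complex)"
    by (simp add: extremal_def dist_norm norm_minus_commute)
  also have "\<dots> = 1 - lam / 2"
    using assms by (simp only: norm_of_real)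
  finally show "boundary_dist (extremal lam) \<le> 1 - lam / 2" .
  show "1 - lam / 2 \<le> boundary_dist (extremal lam)"
    using extremal_FH0_coeff[OF assms(1)] boundary_dist_H0_ge assms by (auto simp: FH0_coeff_def)
qed

theorem theorem2p7:
  fixes lam :: real
  assumes "0 < lam" and "lam \<le> 1"
  shows "(\<forall>f a b. FH0_coeff lam f a b \<longrightarrow>
            (\<forall>z::complex. norm z < 1 \<longrightarrow>
               norm z - lam / 2 * (norm z)\<^sup>2 \<le> norm (f z) \<and>
               norm (f z) \<le> norm z + lam / 2 * (norm z)\<^sup>2) \<and>
            (\<forall>z::complex. norm z \<le> r_star lam \<longrightarrow> bohr_sum a b (norm z) \<le> boundary_dist f)) \<and>
         is_bohr_radius lam (r_star lam) \<and>
         FH0_coeff lam (extremal lam) (extremal_a lam) (\<lambda>_. 0) \<and>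
         (\<forall>z::complex. norm z < 1 \<longrightarrow>
            (bohr_sum (extremal_a lam) (\<lambda>_. 0) (norm z) \<le> boundary_dist (extremal lam)
               \<longleftrightarrow> norm z \<le> r_star lam)) \<and>
         (\<forall>z::complex. norm z = r_star lam \<longrightarrow>
            bohr_sum (extremal_a lam) (\<lambda>_. 0) (norm z) = boundary_dist (extremal lam))"
proof -
  note rs = r_star_bounds[OF assms]
  have bohr: "bohr_sum a b (norm z) \<le> boundary_dist f"
    if "FH0_coeff lam f a b" "norm z \<le> r_star lam" for f a b and z :: complex
  proof -
    have "H0_expansion f a b" "coeff_condition lam a b"
      using that(1) by (auto simp: FH0_coeff_def)
    then have "bohr_sum a b (norm z) \<le> norm z + lam / 2 * (norm z)\<^sup>2"
      and "1 - lam / 2 \<le> boundary_dist f"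
      using bohr_sum_le boundary_dist_H0_ge assms rs that(2) by auto
    moreover have "norm z + lam / 2 * (norm z)\<^sup>2 \<le> 1 - lam / 2"
      using le_r_star_iff[OF assms, of "norm z"] that(2) by simp
    ultimately show ?thesis by simp
  qed
  \<comment> \<open>For the extremal function both estimates behind \<open>bohr\<close> are
    equalities, so the Bohr inequality is exactly the quadratic one. This gives sharpness.\<close>
  have ext: "bohr_sum (extremal_a lam) (\<lambda>_. 0) r \<le> boundary_dist (extremal lam) \<longleftrightarrow> r \<le> r_star lam"
    if "0 \<le> r" for r
    using le_r_star_iff[OF assms that] assms
    by (simp only: bohr_sum_extremal boundary_dist_extremal)
  have "r_star lam \<in> bohr_radii lam"
    using rs bohr by (auto simp: bohr_radii_def)
  moreover have "r \<le> r_star lam" if "r \<in> bohr_radii lam" for r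
  proof -
    have r: "0 \<le> r"
      using that by (simp add: bohr_radii_def)
    \<comment> \<open>The real point \<open>r\<close> itself is the test point in the condition
      defining \<open>bohr_radii\<close>.\<close>
    then have "norm (of_real r :: complex) \<le> r" by simp
    then have "bohr_sum (extremal_a lam) (\<lambda>_. 0) (norm (of_real r :: complex))
        \<le> boundary_dist (extremal lam)"
      using that extremal_FH0_coeff[OF assms(1)] unfolding bohr_radii_def by blast
    with r show ?thesis using ext by simp
  qed
  ultimately have "is_bohr_radius lam (r_star lam)"
    by (simp add: is_bohr_radius_def)
  moreover have "bohr_sum (extremal_a lam) (\<lambda>_. 0) (r_star lam) = boundary_dist (extremal lam)"
    using assms by (simp only: bohr_sum_extremal boundary_dist_extremal r_star_root)
  ultimately show ?thesis
    using bohr ext extremal_FH0_coeff[OF assms(1)] growth_bounds by (auto simp: FH0_coeff_def)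
qed

end
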